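(* Let $f:\mathbb{R}^n\to\mathbb{R}\cup\{\infty\}$ be continuously differentiable, let $g$ be a sharp-peak function with constant $c>0$, let $\varphi(\mathbf{x})=\sum_{i=1}^n g(x_i)$, let $\mathbb{B}=[0,1]^n$, and let $\mu>\overline{\mu}:=\max_{\mathbf{x}\in\mathbb{B}}\|\nabla f(\mathbf{x})\|_\infty/c$. The following relationships hold for the problem $\min_{\mathbf{x}\in\mathbb{B}}F(\mathbf{x};\mu):=f(\mathbf{x})+\mu\varphi(\mathbf{x})$: 1) A P-stationary point is a KKT point. Conversely, a KKT point is a P-stationary point if $\varphi$ is locally convex around this point. 2) A local minimizer is a P-stationary point if either $f$ and $\varphi$ are locally convex around this point or $f$ is $L$-strongly smooth on $\mathbb{B}$ (for some $L>0$). 3) A P-stationary point with $\tau\geq 1/\ell$ is a global minimizer if $f$ is $\ell$-strongly convex on $\mathbb{B}$ (where $\ell>0$).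
   Context: Let $B=[0,1]$ and $\mathbb{B}=[0,1]^n$. $\partial$ denotes the limiting subdifferential (Rockafellar–Wets, Definition 8.3), $N_{C}(\cdot)$ the normal cone of a convex set $C$, and $\delta_C$ the indicator function of $C$ ($0$ on $C$, $+\infty$ off $C$). Sharp-peak function (SPF): $g:\mathbb{R}\to\mathbb{R}\cup\{\infty\}$ is an SPF if (c1) for any $x\in B$, $g(x)\geq 0$, and $g(x)=0$ if and only if $x\in\{0,1\}$; (c2) $g$ is lower semi-continuous on $B$ and there is a constant $c>0$ with $|\nu|\geq c$ for all $\nu\in\partial g(x)$ and all $x\in B$ ($\partial g(x)=\emptyset$ is allowed); (c3) $\partial(g+\delta_B)(x)=\partial g(x)+N_B(x)$ for any $x\in\{0,1\}$. The constant $c$ in the definition of $\overline{\mu}$ is the constant from (c2). KKT point: $\widetilde{\mathbf{x}}\in\mathbb{B}$ is a KKT point if $0\in\nabla f(\widetilde{\mathbf{x}})+\mu\,\partial\varphi(\widetilde{\mathbf{x}})+N_{\mathbb{B}}(\widetilde{\mathbf{x}})$. P-stationary point: $\overline{\mathbf{x}}$ is a P-stationary point if there is a $\tau>0$ such that $$\overline{\mathbf{x}}\in\operatorname{argmin}_{\mathbf{z}\in\mathbb{B}}\ \tfrac12\|\mathbf{z}-(\overline{\mathbf{x}}-\tau\nabla f(\overline{\mathbf{x}}))\|^2+\tau\mu\varphi(\mathbf{z}).$$ "P-stationary point with $\tau$" means that this inclusion holds for that particular $\tau$. $f$ is $L$-strongly smooth on $\Omega$ ($L>0$) if $f(\mathbf{x})\leq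 f(\mathbf{w})+\langle\nabla f(\mathbf{w}),\mathbf{x}-\mathbf{w}\rangle+\frac{L}{2}\|\mathbf{x}-\mathbf{w}\|^2$ for all $\mathbf{x},\mathbf{w}\in\Omega$; $f$ is $\ell$-strongly convex on $\Omega$ ($\ell>0$) if $f(\mathbf{x})\geq f(\mathbf{w})+\langle\nabla f(\mathbf{w}),\mathbf{x}-\mathbf{w}\rangle+\frac{\ell}{2}\|\mathbf{x}-\mathbf{w}\|^2$ for all $\mathbf{x},\mathbf{w}\in\Omega$. "Locally convex around a point" means convex on a neighbourhood of that point. Local and global minimizers are understood for the problem constrained to $\mathbb{B}$. *)

theory Defs
  imports "HOL-Analysis.Analysis"
begin

text \<open>Functions into the reals with plus infinity are modelled as ereal-valued functions; that they
  avoid minus infinity is always an explicit hypothesis.\<close>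

definition regular_subdiff :: "('a::real_inner \<Rightarrow> ereal) \<Rightarrow> 'a \<Rightarrow> 'a set" where
  "regular_subdiff h x = {v. \<bar>h x\<bar> \<noteq> \<infinity> \<and>
     0 \<le> Liminf (at x) (\<lambda>y. (h y - h x - ereal (v \<bullet> (y - x))) / ereal (norm (y - x)))}"

text \<open>The limiting subdifferential of Rockafellar and Wets; the sequence of base points converges
  together with its function values.\<close>

definition subdiff :: "('a::real_inner \<Rightarrow> ereal) \<Rightarrow> 'a \<Rightarrow> 'a set" where
  "subdiff h x = {v. \<bar>h x\<bar> \<noteq> \<infinity> \<and>
     (\<exists>X V. X \<longlonglongrightarrow> x \<and> (\<lambda>k. h (X k)) \<longlonglongrightarrow> h x \<and>
            (\<forall>k::nat. V k \<in> regular_subdiff h (X k)) \<and> V \<longlonglongrightarrow> v)}"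

definition normal_cone :: "'a::real_inner set \<Rightarrow> 'a \<Rightarrow> 'a set" where
  "normal_cone C x = (if x \<in> C then {v. \<forall>y\<in>C. v \<bullet> (y - x) \<le> 0} else {})"

definition indicator_fun :: "'a set \<Rightarrow> 'a \<Rightarrow> ereal" where
  "indicator_fun C x = (if x \<in> C then 0 else \<infinity>)"

definition lsc_on :: "'a::topological_space set \<Rightarrow> ('a \<Rightarrow> ereal) \<Rightarrow> bool" where
  "lsc_on S h \<longleftrightarrow> (\<forall>x\<in>S. h x \<le> Liminf (at x within S) h)"

text \<open>Sums of sets (in the third condition below and in the KKT condition) are Minkowski sums.\<close>

definition sharp_peak :: "(real \<Rightarrow> ereal) \<Rightarrow> real \<Rightarrow> bool" where
  "sharp_peak g c \<longleftrightarrow>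
     (\<forall>x. g x \<noteq> -\<infinity>) \<and>
     (\<forall>x\<in>{0..1}. 0 \<le> g x \<and> (g x = 0 \<longleftrightarrow> x \<in> {0, 1})) \<and>
     (lsc_on {0..1} g \<and> c > 0 \<and> (\<forall>x\<in>{0..1}. \<forall>\<nu>\<in>subdiff g x. \<bar>\<nu>\<bar> \<ge> c)) \<and>
     (\<forall>x\<in>{0, 1}. subdiff (\<lambda>t. g t + indicator_fun {0..1} t) x = subdiff g x + normal_cone {0..1} x)"

abbreviation unit_cube :: "(real^'n) set" where
  "unit_cube \<equiv> cbox 0 1"

definition separable_sum :: "(real \<Rightarrow> ereal) \<Rightarrow> real^'n \<Rightarrow> ereal" where
  "separable_sum g x = (\<Sum>i\<in>UNIV. g (x $ i))"

text \<open>Differentiability of an extended-valued function at a point presupposes that the function is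
  finite near that point, so the totalization by real_of_ereal is harmless.\<close>

definition has_gradient :: "('a::real_inner \<Rightarrow> ereal) \<Rightarrow> 'a \<Rightarrow> 'a \<Rightarrow> bool" where
  "has_gradient f v x \<longleftrightarrow>
     (\<forall>\<^sub>F y in nhds x. \<bar>f y\<bar> \<noteq> \<infinity>) \<and> GDERIV (\<lambda>y. real_of_ereal (f y)) x :> v"

definition gradient :: "('a::real_inner \<Rightarrow> ereal) \<Rightarrow> 'a \<Rightarrow> 'a" where
  "gradient f x = (THE v. has_gradient f v x)"

lemma has_gradient_unique:
  assumes "has_gradient f v x" "has_gradient f w x"
  shows "v = w"
proof -
  have "((\<lambda>y. real_of_ereal (f y)) has_derivative (\<lambda>h. h \<bullet> v)) (at x)"
    and "((\<lambda>y. real_of_ereal (f y)) has_derivative (\<lambda>h. h \<bullet> w)) (at x)"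
    using assms by (simp_all add: has_gradient_def gderiv_def)
  then have "(\<lambda>h. h \<bullet> v) = (\<lambda>h. h \<bullet> w)"
    by (rule has_derivative_unique)
  then have "(v - w) \<bullet> v = (v - w) \<bullet> w"
    by (rule fun_cong)
  then have "(v - w) \<bullet> (v - w) = 0"
    by (simp add: inner_diff_right)
  then show ?thesis
    by simp
qed

lemma gradient_eq: "has_gradient f v x \<Longrightarrow> gradient f x = v"
  unfolding gradient_def by (rule the_equality) (simp_all add: has_gradient_unique)

text \<open>An extended-valued function is continuously differentiable around a set if it is finite and
  continuously differentiable on some open superset.  Functions that are finite and continuously
  differentiable everywhere are a special case.\<close>

definition continuously_differentiable_around :: "'a::real_inner set \<Rightarrow> ('a \<Rightarrow> ereal) \<Rightarrow> bool" where
  "continuously_differentiable_around S f \<longleftrightarrow>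
     (\<exists>U. open U \<and> S \<subseteq> U \<and> (\<forall>x\<in>U. \<exists>v. has_gradient f v x) \<and> continuous_on U (gradient f))"

definition mu_bar :: "(real^'n \<Rightarrow> ereal) \<Rightarrow> real \<Rightarrow> real" where
  "mu_bar f c = (SUP x\<in>unit_cube. infnorm (gradient f x)) / c"

text \<open>The supremum is a maximum.\<close>

lemma mu_bar_attained:
  fixes f :: "real^'n \<Rightarrow> ereal"
  assumes "continuously_differentiable_around unit_cube f"
  shows "\<exists>x\<in>unit_cube. mu_bar f c = infnorm (gradient f x) / c \<and>
           (\<forall>y\<in>unit_cube. infnorm (gradient f y) \<le> infnorm (gradient f x))"
proof -
  obtain U where "unit_cube \<subseteq> U" "continuous_on U (gradient f)"
    using assms unfolding continuously_differentiable_around_def by (elim exE conjE)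
  then have "continuous_on unit_cube (gradient f)"
    by (metis continuous_on_subset)
  then have "continuous_on unit_cube (\<lambda>x. infnorm (gradient f x))"
    by (rule continuous_on_infnorm)
  moreover have "(0::real^'n) \<in> unit_cube"
    by (simp add: mem_box_cart)
  ultimately obtain x where x: "x \<in> unit_cube"
    "\<forall>y\<in>unit_cube. infnorm (gradient f y) \<le> infnorm (gradient f x)"
    using continuous_attains_sup[OF compact_cbox, of 0 "1::real^'n" "\<lambda>x. infnorm (gradient f x)"]
    by (metis empty_iff)
  have "(SUP y\<in>unit_cube. infnorm (gradient f y)) = infnorm (gradient f x)"
    by (rule cSup_eq_maximum) (use x in blast)+
  then have "mu_bar f c = infnorm (gradient f x) / c"
    unfolding mu_bar_def by (rule arg_cong)
  with x show ?thesis
    by blast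
qed

text \<open>As usual in variational analysis, minimizers are feasible: the minimal value is required to be
  finite.  Without this, every point near which the objective is constantly infinite would be a
  local minimizer.\<close>

definition argmin_on :: "'a set \<Rightarrow> ('a \<Rightarrow> ereal) \<Rightarrow> 'a set" where
  "argmin_on S h = {x \<in> S. h x < \<infinity> \<and> (\<forall>y\<in>S. h x \<le> h y)}"

definition local_minimizer_on :: "'a::topological_space set \<Rightarrow> ('a \<Rightarrow> ereal) \<Rightarrow> 'a \<Rightarrow> bool" where
  "local_minimizer_on S h x \<longleftrightarrow> (\<exists>U. open U \<and> x \<in> U \<and> x \<in> argmin_on (S \<inter> U) h)"

definition objective :: "('a \<Rightarrow> ereal) \<Rightarrow> ('a \<Rightarrow> ereal) \<Rightarrow> real \<Rightarrow> 'a \<Rightarrow> ereal" where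
  "objective f \<phi> \<mu> x = f x + ereal \<mu> * \<phi> x"

definition KKT_point :: "(real^'n \<Rightarrow> ereal) \<Rightarrow> (real^'n \<Rightarrow> ereal) \<Rightarrow> real \<Rightarrow> real^'n \<Rightarrow> bool" where
  "KKT_point f \<phi> \<mu> x \<longleftrightarrow> x \<in> unit_cube \<and>
     0 \<in> gradient f x +o ((*\<^sub>R) \<mu> ` subdiff \<phi> x + normal_cone unit_cube x)"

definition P_stationary_with ::
    "(real^'n \<Rightarrow> ereal) \<Rightarrow> (real^'n \<Rightarrow> ereal) \<Rightarrow> real \<Rightarrow> real \<Rightarrow> real^'n \<Rightarrow> bool" where
  "P_stationary_with f \<phi> \<mu> \<tau> x \<longleftrightarrow> \<tau> > 0 \<and>
     x \<in> argmin_on unit_cube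
           (\<lambda>z. ereal (1/2 * (norm (z - (x - \<tau> *\<^sub>R gradient f x)))\<^sup>2) + ereal (\<tau> * \<mu>) * \<phi> z)"

definition P_stationary ::
    "(real^'n \<Rightarrow> ereal) \<Rightarrow> (real^'n \<Rightarrow> ereal) \<Rightarrow> real \<Rightarrow> real^'n \<Rightarrow> bool" where
  "P_stationary f \<phi> \<mu> x \<longleftrightarrow> (\<exists>\<tau>. P_stationary_with f \<phi> \<mu> \<tau> x)"

definition strongly_smooth_on :: "'a::real_inner set \<Rightarrow> real \<Rightarrow> ('a \<Rightarrow> ereal) \<Rightarrow> bool" where
  "strongly_smooth_on S L f \<longleftrightarrow> (\<forall>x\<in>S. \<forall>w\<in>S.
     f x \<le> f w + ereal (gradient f w \<bullet> (x - w)) + ereal (L / 2 * (norm (x - w))\<^sup>2))"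

definition strongly_convex_on :: "'a::real_inner set \<Rightarrow> real \<Rightarrow> ('a \<Rightarrow> ereal) \<Rightarrow> bool" where
  "strongly_convex_on S l f \<longleftrightarrow> (\<forall>x\<in>S. \<forall>w\<in>S.
     f x \<ge> f w + ereal (gradient f w \<bullet> (x - w)) + ereal (l / 2 * (norm (x - w))\<^sup>2))"

definition ereal_convex_on :: "'a::real_vector set \<Rightarrow> ('a \<Rightarrow> ereal) \<Rightarrow> bool" where
  "ereal_convex_on S h \<longleftrightarrow> convex S \<and> (\<forall>x\<in>S. \<forall>y\<in>S. \<forall>t. 0 < t \<and> t < 1 \<longrightarrow>
     h ((1 - t) *\<^sub>R x + t *\<^sub>R y) \<le> ereal (1 - t) * h x + ereal t * h y)"

definition locally_convex_at :: "('a::real_normed_vector \<Rightarrow> ereal) \<Rightarrow> 'a \<Rightarrow> bool" where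
  "locally_convex_at h x \<longleftrightarrow> (\<exists>U. open U \<and> x \<in> U \<and> ereal_convex_on U h)"

end

theory Submission
  imports Defs
begin

text \<open>
  Write \<open>d = z - x\<close>.  Expanding the square in the proximal problem shows that a feasible
  point \<open>x\<close> with finite \<open>\<phi> x\<close> is P-stationary with \<open>\<tau>\<close> iff for all feasible \<open>z\<close> with finite \<open>\<phi> z\<close>
  \<open>gradient f x \<bullet> d + \<mu> * (\<phi> z - \<phi> x) \<ge> - (norm d)\<^sup>2 / (2 * \<tau>)\<close>
  (lemma \<open>P_stationary_with_iff\<close>).  The left-hand side is the first-order model of the change of the
  objective, so every part of the theorem compares this inequality with a bound on that model.
  Division by \<open>\<mu>\<close> is possible throughout, because \<open>\<mu> > mu_bar f c \<ge> 0\<close>.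

  \<^item> From P-stationarity to KKT: moving one coordinate at a time turns the inequality into the
    statement that \<open>- (gradient f x $ i) / \<mu>\<close> is a regular subgradient of \<open>g + \<delta>\<close>, where \<open>\<delta>\<close> is
    the indicator function of the unit interval.  At the end points the sum rule for \<open>g + \<delta>\<close> that
    every sharp-peak function satisfies splits this number into a limiting subgradient of \<open>g\<close> and
    a normal of the interval; at interior points the indicator vanishes nearby and the normal is zero.  The
    coordinates are put together again because products of one-dimensional subgradients are
    subgradients of the separable sum (lemma \<open>subdiff_separable_sum\<close>).

  \<^item> Towards P-stationarity: since \<open>\<phi>\<close> is nonnegative on the cube, a quadratic lower bound on the
    model near \<open>x\<close> implies one on the whole cube, at the price of a smaller \<open>\<tau>\<close> (lemma
    \<open>P_stationary_if_local_bound\<close>).  The local bound comes from the subgradient inequality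
    for the locally convex \<open>\<phi>\<close> at a KKT point, from convexity of \<open>\<phi>\<close> along segments at a local
    minimizer (lemma \<open>convex_first_order_bound\<close> serves both), or from strong smoothness, which bounds
    the actual change of \<open>f\<close> by the linear model plus \<open>L / 2 * (norm d)\<^sup>2\<close>.

  \<^item> From P-stationarity to global minimality: strong convexity adds \<open>l / 2 * (norm d)\<^sup>2\<close> to the
    linear model of \<open>f\<close>, and this outweighs \<open>(norm d)\<^sup>2 / (2 * \<tau>)\<close> when \<open>\<tau> \<ge> 1 / l\<close>.
\<close>

section \<open>Subgradients as first-order lower bounds\<close>

text \<open>Replaces the difference quotients by inequalities without division; these can be added
  over coordinates and restricted to segments.\<close>

lemma mem_regular_subdiff_iff:
  fixes x :: "'a::real_inner"
  shows "v \<in> regular_subdiff h x \<longleftrightarrow> \<bar>h x\<bar> \<noteq> \<infinity> \<and>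
    (\<forall>e>0. \<forall>\<^sub>F y in nhds x. h x + ereal (v \<bullet> (y - x) - e * norm (y - x)) \<le> h y)"
proof (cases "\<bar>h x\<bar> = \<infinity>")
  case False
  then obtain r where r: "h x = ereal r" by auto
  have quot: "ereal b < (h y - h x - ereal (v \<bullet> (y - x))) / ereal (norm (y - x)) \<longleftrightarrow>
      h x + ereal (v \<bullet> (y - x) + b * norm (y - x)) < h y" if "y \<noteq> x" for y b
    using that by (cases "h y") (auto simp: r field_simps)
  have "0 \<le> Liminf (at x) (\<lambda>y. (h y - h x - ereal (v \<bullet> (y - x))) / ereal (norm (y - x))) \<longleftrightarrow>
      (\<forall>e>0. \<forall>\<^sub>F y in nhds x. h x + ereal (v \<bullet> (y - x) - e * norm (y - x)) \<le> h y)"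
    (is "0 \<le> Liminf _ ?q \<longleftrightarrow> ?R")
  proof
    assume L: "0 \<le> Liminf (at x) ?q"
    show ?R
    proof (intro allI impI)
      fix e :: real assume "e > 0"
      then have "\<forall>\<^sub>F y in at x. ereal (- e) < ?q y"
        using L by (auto simp: le_Liminf_iff)
      then have "\<forall>\<^sub>F y in at x. h x + ereal (v \<bullet> (y - x) - e * norm (y - x)) \<le> h y"
        unfolding eventually_at_filter
        by eventually_elim (use quot in \<open>force simp: algebra_simps\<close>)
      then show "\<forall>\<^sub>F y in nhds x. h x + ereal (v \<bullet> (y - x) - e * norm (y - x)) \<le> h y"
        unfolding eventually_at_filter by eventually_elim (auto simp: r)
    qed
  next
    assume R: ?R
    show "0 \<le> Liminf (at x) ?q"
      unfolding le_Liminf_iff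
    proof (intro allI impI)
      fix b :: ereal assume "b < 0"
      then obtain e :: real where e: "e > 0" "b \<le> ereal (- 2 * e)"
      \<comment> \<open>The factor 2 turns the weak inequality supplied by \<open>R\<close> into the strict one required here.\<close>
      proof (cases b)
        case (real s)
        with \<open>b < 0\<close> that[of "- s / 2"] show thesis by auto
      next
        case MInf
        with that[of 1] show thesis by auto
      qed auto
      from R e(1) have "\<forall>\<^sub>F y in nhds x. h x + ereal (v \<bullet> (y - x) - e * norm (y - x)) \<le> h y"
        by blast
      then have "\<forall>\<^sub>F y in at x. ereal (- 2 * e) < ?q y"
        unfolding eventually_at_filter
      proof eventually_elim
        case (elim y)
        show ?case
        proof (intro impI)
          assume "y \<noteq> x"
          have "e * norm (y - x) > 0" using e \<open>y \<noteq> x\<close> by simp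
          then have "h x + ereal (v \<bullet> (y - x) + (- 2 * e) * norm (y - x)) < h y"
            using elim by (cases "h y") (auto simp: r)
          then show "ereal (- 2 * e) < ?q y"
            using quot[OF \<open>y \<noteq> x\<close>, of "- 2 * e"] by simp
        qed
      qed
      then show "\<forall>\<^sub>F y in at x. b < ?q y"
        by eventually_elim (use e(2) in \<open>rule le_less_trans\<close>)
    qed
  qed
  with False show ?thesis by (simp add: regular_subdiff_def)
qed (simp add: regular_subdiff_def)

lemma regular_subdiff_subset_subdiff: "regular_subdiff h x \<subseteq> subdiff h x"
proof
  fix v assume v: "v \<in> regular_subdiff h x"
  then have "\<bar>h x\<bar> \<noteq> \<infinity>" by (simp add: regular_subdiff_def)
  with v show "v \<in> subdiff h x"
    unfolding subdiff_def
    by (intro CollectI conjI exI[of _ "\<lambda>_. x"] exI[of _ "\<lambda>_. v"] allI tendsto_const)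
qed

section \<open>Separable sums and products of intervals\<close>

lemma separable_sum_not_MInf:
  assumes "\<And>t. g t \<noteq> -\<infinity>"
  shows "separable_sum g x \<noteq> -\<infinity>"
proof -
  have "finite I \<Longrightarrow> (\<Sum>i\<in>I. g (x $ i)) \<noteq> -\<infinity>" for I
    by (induction I rule: finite_induct) (use assms in auto)
  then show ?thesis by (simp add: separable_sum_def)
qed

lemma separable_sum_finite_component:
  assumes "separable_sum g x < \<infinity>" "\<And>t. g t \<noteq> -\<infinity>"
  shows "\<bar>g (x $ i)\<bar> \<noteq> \<infinity>"
  using assms(1) assms(2)[of "x $ i"] unfolding separable_sum_def
  by (auto simp: sum_Pinfty less_top[symmetric] top_ereal_def)

text \<open>Each of the \<open>n\<close> coordinate errors is at most the norm of the whole displacement, so giving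
  every coordinate the tolerance \<open>e / n\<close> keeps the total error below \<open>e\<close>.\<close>

lemma regular_subdiff_separable_sum:
  fixes v x :: "real^'n"
  assumes "\<And>i. v $ i \<in> regular_subdiff g (x $ i)"
  shows "v \<in> regular_subdiff (separable_sum g) x"
  unfolding mem_regular_subdiff_iff
proof (intro conjI allI impI)
  have fin: "\<bar>g (x $ i)\<bar> \<noteq> \<infinity>" for i
    using assms by (simp add: regular_subdiff_def)
  define r where "r i = real_of_ereal (g (x $ i))" for i
  have r: "g (x $ i) = ereal (r i)" for i
    using fin[of i] by (simp add: r_def ereal_real')
  have sumx: "separable_sum g x = ereal (\<Sum>i\<in>UNIV. r i)"
    by (simp add: separable_sum_def r)
  then show "\<bar>separable_sum g x\<bar> \<noteq> \<infinity>" by simp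
  fix e :: real assume "e > 0"
  define d where "d = e / real CARD('n)"
  have "d > 0" and d: "real CARD('n) * d = e" using \<open>e > 0\<close> by (simp_all add: d_def)
  have "\<forall>\<^sub>F y in nhds x. g (x $ i) + ereal (v $ i * (y $ i - x $ i) - d * norm (y $ i - x $ i))
      \<le> g (y $ i)" for i
  proof -
    have "\<forall>\<^sub>F s in nhds (x $ i).
        g (x $ i) + ereal (v $ i * (s - x $ i) - d * norm (s - x $ i)) \<le> g s"
      using assms[of i] \<open>d > 0\<close> by (simp add: mem_regular_subdiff_iff)
    moreover have "filterlim (\<lambda>y. y $ i) (nhds (x $ i)) (nhds x)"
      by (intro tendsto_intros filterlim_ident)
    ultimately show ?thesis by (rule eventually_compose_filterlim)
  qed
  then have "\<forall>\<^sub>F y in nhds x. \<forall>i. g (x $ i) +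
      ereal (v $ i * (y $ i - x $ i) - d * norm (y $ i - x $ i)) \<le> g (y $ i)"
    by (simp add: eventually_all_finite)
  then show "\<forall>\<^sub>F y in nhds x. separable_sum g x + ereal (v \<bullet> (y - x) - e * norm (y - x))
      \<le> separable_sum g y"
  proof eventually_elim
    case (elim y)
    have "(\<Sum>i\<in>UNIV. d * norm (y $ i - x $ i)) \<le> (\<Sum>i\<in>(UNIV::'n set). d * norm (y - x))"
      using \<open>d > 0\<close> component_le_norm_cart[of "y - x"]
      by (intro sum_mono mult_left_mono) auto
    also have "\<dots> = e * norm (y - x)" by (simp add: d[symmetric])
    finally have "(\<Sum>i\<in>UNIV. r i) + (v \<bullet> (y - x) - e * norm (y - x)) \<le>
        (\<Sum>i\<in>UNIV. r i + (v $ i * (y $ i - x $ i) - d * norm (y $ i - x $ i)))"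
      by (simp add: sum.distrib sum_subtractf inner_vec_def)
    then have "separable_sum g x + ereal (v \<bullet> (y - x) - e * norm (y - x)) \<le>
        (\<Sum>i\<in>UNIV. g (x $ i) + ereal (v $ i * (y $ i - x $ i) - d * norm (y $ i - x $ i)))"
      by (simp add: sumx r)
    also have "\<dots> \<le> separable_sum g y"
      unfolding separable_sum_def by (intro sum_mono) (use elim in blast)
    finally show ?case .
  qed
qed

text \<open>The approximating sequences of the coordinates are run in parallel.  Attentive convergence
  survives because the values \<open>g (x $ i)\<close> are finite, so that their sum is a limit of real sums.\<close>

lemma subdiff_separable_sum:
  fixes v x :: "real^'n"
  assumes "\<And>i. v $ i \<in> subdiff g (x $ i)"
  shows "v \<in> subdiff (separable_sum g) x"
proof -
  have "\<exists>X V. X \<longlonglongrightarrow> x $ i \<and> (\<lambda>k. g (X k)) \<longlonglongrightarrow> g (x $ i) \<and>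
      (\<forall>k::nat. V k \<in> regular_subdiff g (X k)) \<and> V \<longlonglongrightarrow> v $ i" for i
    using assms[of i] by (simp add: subdiff_def)
  then obtain X V where X: "\<And>i. X i \<longlonglongrightarrow> x $ i"
    and gX: "\<And>i. (\<lambda>k. g (X i k)) \<longlonglongrightarrow> g (x $ i)"
    and V: "\<And>i k. V i k \<in> regular_subdiff g (X i (k::nat))" "\<And>i. V i \<longlonglongrightarrow> v $ i"
    by metis
  have fin: "\<bar>g (x $ i)\<bar> \<noteq> \<infinity>" for i
    using assms by (simp add: subdiff_def)
  define r where "r i = real_of_ereal (g (x $ i))" for i
  have r: "g (x $ i) = ereal (r i)" for i
    using fin[of i] by (simp add: r_def ereal_real')
  have finX: "\<bar>g (X i k)\<bar> \<noteq> \<infinity>" for i k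
    using V(1)[of i k] by (simp add: regular_subdiff_def)
  define s where "s i k = real_of_ereal (g (X i k))" for i k
  have s: "g (X i k) = ereal (s i k)" for i k
    using finX[of i k] by (simp add: s_def ereal_real')
  have "(\<lambda>k. \<Sum>i\<in>UNIV. s i k) \<longlonglongrightarrow> (\<Sum>i\<in>UNIV. r i)"
    using gX by (intro tendsto_sum) (simp add: r s)
  then have "(\<lambda>k. separable_sum g (\<chi> i. X i k)) \<longlonglongrightarrow> separable_sum g x"
    by (simp add: separable_sum_def r s)
  moreover have "(\<lambda>k. \<chi> i. X i k) \<longlonglongrightarrow> x" "(\<lambda>k. \<chi> i. V i k) \<longlonglongrightarrow> v"
    using X V(2) by (auto intro!: vec_tendstoI)
  moreover have "(\<chi> i. V i k) \<in> regular_subdiff (separable_sum g) (\<chi> i. X i k)" for k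
    using V(1) by (intro regular_subdiff_separable_sum) simp
  moreover have "\<bar>separable_sum g x\<bar> \<noteq> \<infinity>"
    by (simp add: separable_sum_def r)
  ultimately show ?thesis
    unfolding subdiff_def
    by (intro CollectI conjI exI[of _ "\<lambda>k. \<chi> i. X i k"] exI[of _ "\<lambda>k. \<chi> i. V i k"] allI)
qed

lemma normal_cone_unit_cube:
  fixes m x :: "real^'n"
  assumes "\<And>i. m $ i \<in> normal_cone {0..1} (x $ i)"
  shows "m \<in> normal_cone unit_cube x"
proof -
  have m: "x $ i \<in> {0..1} \<and> (\<forall>t\<in>{0..1}. m $ i * (t - x $ i) \<le> 0)" for i
    using assms[of i] by (auto simp: normal_cone_def split: if_splits)
  then have "x \<in> unit_cube"
    by (auto simp: mem_box_cart)
  moreover have "m \<bullet> (y - x) \<le> 0" if "y \<in> unit_cube" for y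
    unfolding inner_vec_def
    by (intro sum_nonpos) (use that m in \<open>auto simp: mem_box_cart\<close>)
  ultimately show ?thesis
    by (simp add: normal_cone_def)
qed

section \<open>First-order bounds for convex functions\<close>

text \<open>Along the segment from \<open>x\<close> to \<open>z\<close> the increment of a convex function grows at most linearly,
  so a lower bound up to \<open>o(norm (y - x))\<close> at the start forces the exact bound at \<open>z\<close>.  The bound
  is only required on \<open>S\<close>: it applies to open sets, where it is the
  subgradient inequality, and to the part of the feasible set in a neighbourhood, where the
  constrained minimality of \<open>x\<close> provides it.\<close>

lemma convex_first_order_bound:
  fixes x :: "'a::real_inner"
  assumes "ereal_convex_on S h" "x \<in> S" "z \<in> S" "h x = ereal r" "h z = ereal s"
    and bound: "\<And>e. e > 0 \<Longrightarrow>
      \<forall>\<^sub>F y in nhds x. y \<in> S \<longrightarrow> h x + ereal (v \<bullet> (y - x) - e * norm (y - x)) \<le> h y"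
  shows "r + v \<bullet> (z - x) \<le> s"
proof -
  let ?d = "z - x"
  have main: "v \<bullet> ?d \<le> s - r + e * norm ?d" if "e > 0" for e
  proof -
    have lim: "filterlim (\<lambda>t. x + t *\<^sub>R ?d) (nhds x) (at_right 0)"
      by (auto intro!: tendsto_eq_intros)
    have "\<forall>\<^sub>F t in at_right 0. x + t *\<^sub>R ?d \<in> S \<longrightarrow>
        h x + ereal (v \<bullet> (x + t *\<^sub>R ?d - x) - e * norm (x + t *\<^sub>R ?d - x)) \<le> h (x + t *\<^sub>R ?d)"
      by (rule eventually_compose_filterlim[OF bound[OF that] lim])
    moreover have "\<forall>\<^sub>F t in at_right (0::real). t \<in> {0<..<1}"
      by (rule eventually_at_right_real) simp
    ultimately have "\<forall>\<^sub>F t in at_right (0::real). v \<bullet> ?d \<le> s - r + e * norm ?d"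
    proof eventually_elim
      case (elim t)
      then have t: "0 < t" "t < 1" by auto
      have eq: "x + t *\<^sub>R ?d = (1 - t) *\<^sub>R x + t *\<^sub>R z" by (simp add: algebra_simps)
      have "h (x + t *\<^sub>R ?d) \<le> ereal (1 - t) * h x + ereal t * h z"
        using assms(1-3) t unfolding eq ereal_convex_on_def by blast
      moreover have "x + t *\<^sub>R ?d \<in> S"
        using assms(1-3) t unfolding eq ereal_convex_on_def convex_alt by auto
      ultimately have "h x + ereal (v \<bullet> (t *\<^sub>R ?d) - e * norm (t *\<^sub>R ?d)) \<le>
          ereal (1 - t) * h x + ereal t * h z"
        using elim by (force simp del: inner_scaleR_right norm_scaleR)
      then have "r + (t * (v \<bullet> ?d) - e * (t * norm ?d)) \<le> (1 - t) * r + t * s"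
        using t by (simp add: assms(4,5) del: inner_diff_right)
      then have "0 \<le> t * (s - r + e * norm ?d - v \<bullet> ?d)"
        by (simp only: algebra_simps)
      with t show ?case by (simp add: zero_le_mult_iff)
    qed
    then show ?thesis by simp
  qed
  have lim: "((\<lambda>e. s - r + e * norm ?d) \<longlongrightarrow> s - r) (at_right 0)"
    by (auto intro!: tendsto_eq_intros)
  have "v \<bullet> ?d \<le> s - r"
    by (rule tendsto_lowerbound[OF lim])
       (auto simp: eventually_at_filter main)
  then show ?thesis by simp
qed

text \<open>The inequality holds at the base points of the approximating sequence, which eventually lie
  in \<open>U\<close>, and passes to the limit because the function values converge as well.\<close>

lemma subdiff_convex_bound:
  fixes x :: "'a::real_inner"
  assumes conv: "ereal_convex_on U h" and "open U" "x \<in> U" "z \<in> U"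
    and v: "v \<in> subdiff h x" and hx: "h x = ereal r" and hz: "h z = ereal s"
  shows "r + v \<bullet> (z - x) \<le> s"
proof -
  obtain X V where X: "X \<longlonglongrightarrow> x" and hX: "(\<lambda>k. h (X k)) \<longlonglongrightarrow> h x"
    and V: "\<And>k::nat. V k \<in> regular_subdiff h (X k)" "V \<longlonglongrightarrow> v"
    using v unfolding subdiff_def by blast
  have finX: "\<bar>h (X k)\<bar> \<noteq> \<infinity>" for k
    using V(1)[of k] by (simp add: regular_subdiff_def)
  define p where "p k = real_of_ereal (h (X k))" for k
  have p: "h (X k) = ereal (p k)" for k
    using finX[of k] by (simp add: p_def ereal_real')
  have lim: "(\<lambda>k. p k + V k \<bullet> (z - X k)) \<longlonglongrightarrow> r + v \<bullet> (z - x)"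
    using hX X V(2) by (intro tendsto_intros) (simp_all add: p hx)
  have "\<forall>\<^sub>F k in sequentially. X k \<in> U"
    using X \<open>open U\<close> \<open>x \<in> U\<close> by (rule topological_tendstoD)
  then have "\<forall>\<^sub>F k in sequentially. p k + V k \<bullet> (z - X k) \<le> s"
  proof eventually_elim
    case (elim k)
    show ?case
    proof (rule convex_first_order_bound[OF conv elim \<open>z \<in> U\<close> p hz])
      fix e :: real assume "e > 0"
      then have "\<forall>\<^sub>F y in nhds (X k).
          h (X k) + ereal (V k \<bullet> (y - X k) - e * norm (y - X k)) \<le> h y"
        using V(1) by (simp add: mem_regular_subdiff_iff)
      then show "\<forall>\<^sub>F y in nhds (X k). y \<in> U \<longrightarrow>
          h (X k) + ereal (V k \<bullet> (y - X k) - e * norm (y - X k)) \<le> h y"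
        by eventually_elim simp
    qed
  qed
  then show ?thesis
    by (intro tendsto_upperbound[OF lim]) auto
qed

section \<open>P-stationarity as a quadratic variational inequality\<close>

lemma has_gradient_finite:
  assumes "has_gradient f v x"
  shows "\<bar>f x\<bar> \<noteq> \<infinity>"
proof -
  have "\<forall>\<^sub>F y in nhds x. \<bar>f y\<bar> \<noteq> \<infinity>"
    using assms by (simp only: has_gradient_def)
  then show ?thesis by (rule eventually_nhds_x_imp_x)
qed

lemma has_gradient_upper_bound:
  fixes x :: "'a::real_inner"
  assumes "has_gradient f v x" "e > 0"
  shows "\<forall>\<^sub>F y in nhds x. f y \<le> f x + ereal (v \<bullet> (y - x) + e * norm (y - x))"
proof -
  let ?f = "\<lambda>y. real_of_ereal (f y)"
  have fin: "\<forall>\<^sub>F y in nhds x. \<bar>f y\<bar> \<noteq> \<infinity>" and "(?f has_derivative (\<lambda>h. h \<bullet> v)) (at x)"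
    using assms(1) by (simp_all add: has_gradient_def gderiv_def)
  then obtain d where "d > 0"
    and d: "\<And>y. norm (y - x) < d \<Longrightarrow> norm (?f y - ?f x - (y - x) \<bullet> v) \<le> e * norm (y - x)"
    using assms(2) unfolding has_derivative_at_alt by blast
  have "\<forall>\<^sub>F y in nhds x. norm (y - x) < d"
    using \<open>d > 0\<close> by (auto simp: eventually_nhds_metric dist_norm)
  with fin show ?thesis
  proof eventually_elim
    case (elim y)
    have "\<bar>f x\<bar> \<noteq> \<infinity>" using assms(1) by (rule has_gradient_finite)
    with elim d[of y] show ?case
      by (cases "f y"; cases "f x") (auto simp: inner_commute)
  qed
qed

text \<open>Expanding the square, the constant \<open>(norm (\<tau> *\<^sub>R gradient f x))\<^sup>2 / 2\<close> cancels from both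
  sides of the minimality condition; the rest is divided by \<open>\<tau>\<close>.\<close>

lemma P_stationary_with_iff:
  fixes x :: "real^'n"
  assumes "\<And>z. \<phi> z \<noteq> -\<infinity>" "\<mu> > 0"
  shows "P_stationary_with f \<phi> \<mu> \<tau> x \<longleftrightarrow> \<tau> > 0 \<and> x \<in> unit_cube \<and> \<phi> x < \<infinity> \<and>
    (\<forall>z\<in>unit_cube. \<forall>r s. \<phi> x = ereal r \<and> \<phi> z = ereal s \<longrightarrow>
       - ((norm (z - x))\<^sup>2 / (2 * \<tau>)) \<le> gradient f x \<bullet> (z - x) + \<mu> * (s - r))"
proof (cases "\<tau> > 0 \<and> \<phi> x < \<infinity>")
  case True
  then obtain r where r: "\<phi> x = ereal r" using assms(1)[of x] by (cases "\<phi> x") auto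
  let ?G = "gradient f x"
  let ?P = "\<lambda>z. ereal (1/2 * (norm (z - (x - \<tau> *\<^sub>R ?G)))\<^sup>2) + ereal (\<tau> * \<mu>) * \<phi> z"
  have sq: "(norm (z - (x - \<tau> *\<^sub>R ?G)))\<^sup>2 =
      (norm (z - x))\<^sup>2 + 2 * \<tau> * (?G \<bullet> (z - x)) + (norm (\<tau> *\<^sub>R ?G))\<^sup>2" for z
  proof -
    have "z - (x - \<tau> *\<^sub>R ?G) = (z - x) + \<tau> *\<^sub>R ?G" by simp
    then show ?thesis
      by (simp only: power2_norm_eq_inner) (simp add: inner_add inner_commute algebra_simps)
  qed
  have key: "?P x \<le> ?P z \<longleftrightarrow> (\<forall>s. \<phi> z = ereal s \<longrightarrow>
      - ((norm (z - x))\<^sup>2 / (2 * \<tau>)) \<le> ?G \<bullet> (z - x) + \<mu> * (s - r))" for z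
  proof (cases "\<phi> z")
    case (real s)
    have "?P x \<le> ?P z \<longleftrightarrow> 0 \<le> (norm (z - x))\<^sup>2 / 2 + \<tau> * (?G \<bullet> (z - x)) + \<tau> * \<mu> * (s - r)"
      by (simp only: sq r real plus_ereal.simps times_ereal.simps ereal_less_eq)
         (auto simp: field_simps simp del: norm_scaleR)
    also have "\<dots> \<longleftrightarrow> 0 \<le> ((norm (z - x))\<^sup>2 / 2 + \<tau> * (?G \<bullet> (z - x)) + \<tau> * \<mu> * (s - r)) / \<tau>"
      using True by (simp add: zero_le_divide_iff)
    also have "((norm (z - x))\<^sup>2 / 2 + \<tau> * (?G \<bullet> (z - x)) + \<tau> * \<mu> * (s - r)) / \<tau> =
        (norm (z - x))\<^sup>2 / (2 * \<tau>) + (?G \<bullet> (z - x) + \<mu> * (s - r))"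
      using True by (simp add: field_simps)
    finally show ?thesis by (auto simp: real)
  qed (use assms True in auto)
  have "?P x < \<infinity>" by (simp add: r)
  then show ?thesis
    unfolding P_stationary_with_def argmin_on_def using True key by (auto simp: r)
next
  case False
  then show ?thesis
    using assms(2) unfolding P_stationary_with_def argmin_on_def by auto
qed

text \<open>Away from \<open>x\<close>, at distance at least \<open>d\<close>, the model decreases at most by
  \<open>norm (gradient f x) * norm (z - x) + \<mu> * r\<close>, because \<open>\<phi>\<close> is nonnegative; both
  terms are at most multiples of \<open>(norm (z - x))\<^sup>2\<close> there.  So the quadratic bound extends from the
  neighbourhood to the cube with a larger constant, that is, with a smaller \<open>\<tau>\<close>.\<close>

lemma P_stationary_if_local_bound:
  fixes x :: "real^'n"
  assumes "\<And>z. \<phi> z \<noteq> -\<infinity>" "\<mu> > 0" and nonneg: "\<And>z. z \<in> unit_cube \<Longrightarrow> 0 \<le> \<phi> z"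
    and x: "x \<in> unit_cube" and r: "\<phi> x = ereal r"
    and near: "\<forall>\<^sub>F z in nhds x. z \<in> unit_cube \<longrightarrow> (\<forall>s. \<phi> z = ereal s \<longrightarrow>
      - (K * (norm (z - x))\<^sup>2) \<le> gradient f x \<bullet> (z - x) + \<mu> * (s - r))"
  shows "P_stationary f \<phi> \<mu> x"
proof -
  let ?G = "gradient f x"
  obtain d where "d > 0" and d: "\<And>z s. dist z x < d \<Longrightarrow> z \<in> unit_cube \<Longrightarrow> \<phi> z = ereal s \<Longrightarrow>
      - (K * (norm (z - x))\<^sup>2) \<le> ?G \<bullet> (z - x) + \<mu> * (s - r)"
    using near unfolding eventually_nhds_metric by blast
  have "r \<ge> 0" using nonneg[OF x] by (simp add: r)
  \<comment> \<open>\<open>K\<close> handles the near points, the two quotients the far ones, and 1 makes \<open>M\<close> positive.\<close>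
  define M where "M = 1 + \<bar>K\<bar> + norm ?G / d + \<mu> * r / d\<^sup>2"
  have "M > 0" "K \<le> M" and M: "norm ?G / d + \<mu> * r / d\<^sup>2 \<le> M"
    using \<open>d > 0\<close> \<open>\<mu> > 0\<close> \<open>r \<ge> 0\<close>
    by (auto simp: M_def intro!: add_pos_nonneg add_nonneg_nonneg intro: order_trans[OF abs_ge_self])
  have "- (M * (norm (z - x))\<^sup>2) \<le> ?G \<bullet> (z - x) + \<mu> * (s - r)"
    if z: "z \<in> unit_cube" and s: "\<phi> z = ereal s" for z s
  proof (cases "norm (z - x) < d")
    case True
    have "K * (norm (z - x))\<^sup>2 \<le> M * (norm (z - x))\<^sup>2"
      using \<open>K \<le> M\<close> by (rule mult_right_mono) simp
    with d[of z s] True z s show ?thesis by (simp add: dist_norm)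
  next
    case False
    let ?n = "norm (z - x)"
    have "s \<ge> 0" using nonneg[OF z] by (simp add: s)
    have ratio: "1 \<le> ?n / d" using False \<open>d > 0\<close> by simp
    have "norm ?G * ?n * 1 \<le> norm ?G * ?n * (?n / d)"
      using ratio by (intro mult_left_mono) auto
    then have "- (norm ?G / d * ?n\<^sup>2) \<le> - (norm ?G * ?n)"
      by (simp add: power2_eq_square)
    also have "\<dots> \<le> ?G \<bullet> (z - x)"
      using Cauchy_Schwarz_ineq2[of ?G "z - x"] by simp
    finally have "- (norm ?G / d * ?n\<^sup>2) \<le> ?G \<bullet> (z - x)" .
    moreover have "\<mu> * r * 1 \<le> \<mu> * r * (?n / d)\<^sup>2"
      using ratio \<open>\<mu> > 0\<close> \<open>r \<ge> 0\<close> by (intro mult_left_mono one_le_power) auto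
    moreover have "\<mu> * s \<ge> 0" using \<open>\<mu> > 0\<close> \<open>s \<ge> 0\<close> by simp
    moreover have "(norm ?G / d + \<mu> * r / d\<^sup>2) * ?n\<^sup>2 \<le> M * ?n\<^sup>2"
      using M by (rule mult_right_mono) simp
    ultimately show ?thesis
      by (simp add: algebra_simps power_divide)
  qed
  then have "P_stationary_with f \<phi> \<mu> (1 / (2 * M)) x"
    using \<open>M > 0\<close> x by (simp add: P_stationary_with_iff[OF assms(1,2)] r mult.commute)
  then show ?thesis
    unfolding P_stationary_def by blast
qed

section \<open>P-stationary points and KKT points\<close>

text \<open>Both conditions separate over the coordinates: the variational inequality is tested only with
  points that differ from \<open>x\<close> in one coordinate, and the sum rule of a sharp peak function is applied
  in each coordinate.\<close>

lemma KKT_point_if_P_stationary: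
  fixes x :: "real^'n"
  assumes sp: "sharp_peak g c" and "\<mu> > 0" and P: "P_stationary f (separable_sum g) \<mu> x"
  shows "KKT_point f (separable_sum g) \<mu> x"
proof -
  let ?G = "gradient f x" and ?gB = "\<lambda>t. g t + indicator_fun {0..1} t"
  have g: "\<And>t. g t \<noteq> -\<infinity>"
    using sp by (simp add: sharp_peak_def)
  obtain \<tau> where "P_stationary_with f (separable_sum g) \<mu> \<tau> x"
    using P unfolding P_stationary_def by blast
  then have "\<tau> > 0" and x: "x \<in> unit_cube" and fin: "separable_sum g x < \<infinity>"
    and ineq: "\<And>z r s. z \<in> unit_cube \<Longrightarrow> separable_sum g x = ereal r \<Longrightarrow>
        separable_sum g z = ereal s \<Longrightarrow>
        - ((norm (z - x))\<^sup>2 / (2 * \<tau>)) \<le> ?G \<bullet> (z - x) + \<mu> * (s - r)"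
    by (auto simp: P_stationary_with_iff[OF separable_sum_not_MInf[OF g] \<open>\<mu> > 0\<close>])
  define r where "r i = real_of_ereal (g (x $ i))" for i
  have r: "g (x $ i) = ereal (r i)" for i
    using separable_sum_finite_component[OF fin g, of i] by (simp add: r_def ereal_real')
  have xi: "x $ i \<in> {0..1}" for i
    using x by (auto simp: mem_box_cart)
  have coord: "- ((t - x $ i)\<^sup>2 / (2 * \<tau>)) \<le> ?G $ i * (t - x $ i) + \<mu> * (s - r i)"
    if t: "t \<in> {0..1}" and s: "g t = ereal s" for i t s
  proof -
    define z where "z = (\<chi> j. if j = i then t else x $ j)"
    have "z - x = axis i (t - x $ i)"
      by (simp add: z_def vec_eq_iff axis_def)
    then have "norm (z - x) = \<bar>t - x $ i\<bar>" "?G \<bullet> (z - x) = ?G $ i * (t - x $ i)"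
      by (simp_all add: inner_axis norm_eq_sqrt_inner inner_axis_axis)
    moreover have "z \<in> unit_cube"
      using xi t by (auto simp: z_def mem_box_cart)
    moreover have "separable_sum g z = ereal (s + (\<Sum>j\<in>UNIV - {i}. r j))"
      "separable_sum g x = ereal (r i + (\<Sum>j\<in>UNIV - {i}. r j))"
      by (simp_all add: separable_sum_def sum.remove[of _ i] z_def r s)
    ultimately show ?thesis
      using ineq[of z] by fastforce
  qed
  have reg: "- ?G $ i / \<mu> \<in> regular_subdiff ?gB (x $ i)" for i
    unfolding mem_regular_subdiff_iff
  proof (intro conjI allI impI)
    show "\<bar>?gB (x $ i)\<bar> \<noteq> \<infinity>"
      using xi by (simp add: r indicator_fun_def)
    fix e :: real assume "e > 0"
    \<comment> \<open>Within this radius the quadratic error \<open>(t - x $ i)\<^sup>2 / (2 * \<tau> * \<mu>)\<close> is at most \<open>e * \<bar>t - x $ i\<bar>\<close>.\<close>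
    have "\<forall>\<^sub>F t in nhds (x $ i). dist t (x $ i) < 2 * \<tau> * \<mu> * e"
      using \<open>e > 0\<close> \<open>\<tau> > 0\<close> \<open>\<mu> > 0\<close>
      unfolding eventually_nhds_metric by (intro exI[of _ "2 * \<tau> * \<mu> * e"]) auto
    then show "\<forall>\<^sub>F t in nhds (x $ i).
        ?gB (x $ i) + ereal ((- ?G $ i / \<mu>) \<bullet> (t - x $ i) - e * norm (t - x $ i)) \<le> ?gB t"
    proof eventually_elim
      case (elim t)
      show ?case
      proof (cases "t \<in> {0..1} \<and> g t \<noteq> \<infinity>")
        case True
        then obtain s where s: "g t = ereal s" using g[of t] by (cases "g t") auto
        let ?a = "\<bar>t - x $ i\<bar>"
        have "?a * ?a \<le> ?a * (2 * \<tau> * \<mu> * e)"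
          using elim by (intro mult_left_mono) (auto simp: dist_real_def)
        then have "(t - x $ i)\<^sup>2 / (2 * \<tau>) \<le> \<mu> * (e * ?a)"
          using \<open>\<tau> > 0\<close> by (simp add: field_simps power2_eq_square abs_mult_self_eq)
        with coord[of t s i] True s have "\<mu> * (r i - e * ?a) - ?G $ i * (t - x $ i) \<le> \<mu> * s"
          by (simp add: algebra_simps)
        then have "r i + (- ?G $ i / \<mu> * (t - x $ i) - e * ?a) \<le> s"
          using \<open>\<mu> > 0\<close> by (simp add: field_simps)
        then show ?thesis
          using True xi by (simp add: r s indicator_fun_def)
      next
        case False
        then have "?gB t = \<infinity>" using g[of t] by (auto simp: indicator_fun_def)
        then show ?thesis by (simp only: ereal_less_eq)
      qed
    qed
  qed
  have "\<exists>v m. v \<in> subdiff g (x $ i) \<and> m \<in> normal_cone {0..1} (x $ i) \<and> - ?G $ i / \<mu> = v + m" for i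
  proof (cases "x $ i \<in> {0, 1}")
    case True
    then have "subdiff ?gB (x $ i) = subdiff g (x $ i) + normal_cone {0..1} (x $ i)"
      using sp by (auto simp: sharp_peak_def)
    moreover have "- ?G $ i / \<mu> \<in> subdiff ?gB (x $ i)"
      using reg regular_subdiff_subset_subdiff by blast
    ultimately show ?thesis
      by (auto elim!: set_plus_elim)
  next
    case False
    then have inner: "x $ i \<in> {0<..<1}" using xi[of i] by auto
    have "- ?G $ i / \<mu> \<in> regular_subdiff g (x $ i)"
      unfolding mem_regular_subdiff_iff
    proof (intro conjI allI impI)
      show "\<bar>g (x $ i)\<bar> \<noteq> \<infinity>" by (simp add: r)
      fix e :: real assume "e > 0"
      then have "\<forall>\<^sub>F t in nhds (x $ i).
          ?gB (x $ i) + ereal ((- ?G $ i / \<mu>) \<bullet> (t - x $ i) - e * norm (t - x $ i)) \<le> ?gB t"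
        using reg unfolding mem_regular_subdiff_iff by blast
      moreover have "\<forall>\<^sub>F t in nhds (x $ i). t \<in> {0<..<1}"
        using inner by (intro eventually_nhds_in_open) auto
      ultimately show "\<forall>\<^sub>F t in nhds (x $ i).
          g (x $ i) + ereal ((- ?G $ i / \<mu>) \<bullet> (t - x $ i) - e * norm (t - x $ i)) \<le> g t"
        by eventually_elim (use xi in \<open>auto simp: indicator_fun_def\<close>)
    qed
    then have "- ?G $ i / \<mu> \<in> subdiff g (x $ i)"
      using regular_subdiff_subset_subdiff by blast
    moreover have "0 \<in> normal_cone {0..1} (x $ i)"
      using xi by (simp add: normal_cone_def)
    ultimately show ?thesis by force
  qed
  then obtain v m where v: "\<And>i. v i \<in> subdiff g (x $ i)"
    and m: "\<And>i. m i \<in> normal_cone {0..1} (x $ i)" and eq: "\<And>i. - ?G $ i / \<mu> = v i + m i"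
    by metis
  have "(\<chi> i. v i) \<in> subdiff (separable_sum g) x"
    using v by (intro subdiff_separable_sum) simp
  moreover have "\<mu> *\<^sub>R (\<chi> i. m i) \<in> normal_cone unit_cube x"
  proof (rule normal_cone_unit_cube)
    fix i
    have "\<mu> * m i * (t - x $ i) \<le> 0" if "t \<in> {0..1}" for t
    proof -
      have "m i * (t - x $ i) \<le> 0"
        using m[of i] that xi[of i] by (simp add: normal_cone_def)
      then show ?thesis
        using \<open>\<mu> > 0\<close> by (simp add: mult.assoc mult_nonneg_nonpos)
    qed
    then show "(\<mu> *\<^sub>R (\<chi> i. m i)) $ i \<in> normal_cone {0..1} (x $ i)"
      using xi by (simp add: normal_cone_def)
  qed
  moreover have "0 = ?G + (\<mu> *\<^sub>R (\<chi> i. v i) + \<mu> *\<^sub>R (\<chi> i. m i))"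
  proof -
    have "- ?G $ i = \<mu> * v i + \<mu> * m i" for i
      using eq[of i] \<open>\<mu> > 0\<close> by (simp add: field_simps)
    then show ?thesis
      by (simp add: vec_eq_iff) (metis add.right_inverse)
  qed
  ultimately have "\<mu> *\<^sub>R (\<chi> i. v i) + \<mu> *\<^sub>R (\<chi> i. m i) \<in>
      (*\<^sub>R) \<mu> ` subdiff (separable_sum g) x + normal_cone unit_cube x"
    and "0 = ?G + (\<mu> *\<^sub>R (\<chi> i. v i) + \<mu> *\<^sub>R (\<chi> i. m i))"
    by (blast intro: set_plus_intro)+
  then show ?thesis
    unfolding KKT_point_def elt_set_plus_def using x by blast
qed

text \<open>Write \<open>- gradient f x\<close> as \<open>\<mu> *\<^sub>R v + m\<close>.  The subgradient inequality for \<open>v\<close> and the sign of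
  the normal \<open>m\<close> make the first-order model nonnegative near \<open>x\<close>, which is the local bound with
  constant \<open>0\<close>.\<close>

lemma P_stationary_if_KKT_point:
  fixes x :: "real^'n"
  assumes "\<And>z. \<phi> z \<noteq> -\<infinity>" "\<mu> > 0" "\<And>z. z \<in> unit_cube \<Longrightarrow> 0 \<le> \<phi> z"
    and KKT: "KKT_point f \<phi> \<mu> x" and conv: "locally_convex_at \<phi> x"
  shows "P_stationary f \<phi> \<mu> x"
proof -
  have x: "x \<in> unit_cube" using KKT by (simp add: KKT_point_def)
  obtain v m where v: "v \<in> subdiff \<phi> x" and m: "m \<in> normal_cone unit_cube x"
    and "0 = gradient f x + (\<mu> *\<^sub>R v + m)"
    using KKT by (auto simp: KKT_point_def elt_set_plus_def elim!: set_plus_elim)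
  then have G: "gradient f x = - (\<mu> *\<^sub>R v + m)"
    by (metis eq_neg_iff_add_eq_0)
  obtain r where r: "\<phi> x = ereal r"
    using v by (auto simp: subdiff_def)
  obtain U where U: "open U" "x \<in> U" "ereal_convex_on U \<phi>"
    using conv unfolding locally_convex_at_def by blast
  have "\<forall>\<^sub>F z in nhds x. z \<in> U"
    using U by (intro eventually_nhds_in_open)
  then have near: "\<forall>\<^sub>F z in nhds x. z \<in> unit_cube \<longrightarrow> (\<forall>s. \<phi> z = ereal s \<longrightarrow>
      - (0 * (norm (z - x))\<^sup>2) \<le> gradient f x \<bullet> (z - x) + \<mu> * (s - r))"
  proof (eventually_elim, intro impI allI)
    fix z s assume "z \<in> U" and z: "z \<in> unit_cube" and s: "\<phi> z = ereal s"
    have "\<mu> * (r + v \<bullet> (z - x)) \<le> \<mu> * s"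
      using subdiff_convex_bound[OF U(3,1,2) \<open>z \<in> U\<close> v r s] \<open>\<mu> > 0\<close> by simp
    moreover have "m \<bullet> (z - x) \<le> 0"
      using m x z by (simp add: normal_cone_def)
    ultimately show "- (0 * (norm (z - x))\<^sup>2) \<le> gradient f x \<bullet> (z - x) + \<mu> * (s - r)"
      by (simp add: G inner_add_left inner_minus_left algebra_simps)
  qed
  show ?thesis
    by (rule P_stationary_if_local_bound[where \<phi> = \<phi>, OF assms(1,2) _ x r near]) (rule assms(3))
qed

section \<open>Minimizers and P-stationary points\<close>

lemma local_minimizer_onE:
  assumes min: "local_minimizer_on S (objective f \<phi> \<mu>) x"
    and "\<And>z. \<phi> z \<noteq> -\<infinity>" "\<mu> > 0" and fin: "\<bar>f x\<bar> \<noteq> \<infinity>"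
  obtains r where "x \<in> S" "\<phi> x = ereal r"
    "\<forall>\<^sub>F z in nhds x. z \<in> S \<longrightarrow> objective f \<phi> \<mu> x \<le> objective f \<phi> \<mu> z"
proof -
  obtain U where U: "open U" "x \<in> U" "x \<in> S" and lt: "objective f \<phi> \<mu> x < \<infinity>"
    and le: "\<And>z. z \<in> S \<inter> U \<Longrightarrow> objective f \<phi> \<mu> x \<le> objective f \<phi> \<mu> z"
    using min unfolding local_minimizer_on_def argmin_on_def by blast
  have "\<forall>\<^sub>F z in nhds x. z \<in> U"
    using U by (intro eventually_nhds_in_open)
  then have "\<forall>\<^sub>F z in nhds x. z \<in> S \<longrightarrow> objective f \<phi> \<mu> x \<le> objective f \<phi> \<mu> z"
    by eventually_elim (use le in blast)
  moreover obtain r where "\<phi> x = ereal r"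
    using lt fin assms(2)[of x] \<open>\<mu> > 0\<close> unfolding objective_def
    by (cases "f x"; cases "\<phi> x") auto
  ultimately show thesis
    using that U(3) by blast
qed

text \<open>Near \<open>x\<close> the function \<open>f\<close> exceeds its linearization by at most \<open>o(norm (y - x))\<close>, so local
  minimality makes \<open>- gradient f x / \<mu>\<close> a first-order lower bound of \<open>\<phi>\<close> relative to the cube.
  Convexity of \<open>\<phi>\<close> removes the error term, which again gives the local bound with constant \<open>0\<close>.\<close>

lemma P_stationary_if_local_minimizer_convex:
  fixes x :: "real^'n"
  assumes "\<And>z. \<phi> z \<noteq> -\<infinity>" "\<mu> > 0" "\<And>z. z \<in> unit_cube \<Longrightarrow> 0 \<le> \<phi> z"
    and grad: "has_gradient f (gradient f x) x"
    and min: "local_minimizer_on unit_cube (objective f \<phi> \<mu>) x"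
    and conv: "locally_convex_at \<phi> x"
  shows "P_stationary f \<phi> \<mu> x"
proof -
  let ?G = "gradient f x"
  have "\<bar>f x\<bar> \<noteq> \<infinity>"
    using grad by (rule has_gradient_finite)
  then obtain a where a: "f x = ereal a" by auto
  obtain r where x: "x \<in> unit_cube" and r: "\<phi> x = ereal r"
    and le: "\<forall>\<^sub>F z in nhds x. z \<in> unit_cube \<longrightarrow> objective f \<phi> \<mu> x \<le> objective f \<phi> \<mu> z"
    using local_minimizer_onE[OF min assms(1,2) \<open>\<bar>f x\<bar> \<noteq> \<infinity>\<close>] by metis
  obtain U where U: "open U" "x \<in> U" "ereal_convex_on U \<phi>"
    using conv unfolding locally_convex_at_def by blast
  have conv': "ereal_convex_on (unit_cube \<inter> U) \<phi>"
    using U(3) unfolding ereal_convex_on_def by (auto intro: convex_Int)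
  have bound: "\<forall>\<^sub>F y in nhds x. y \<in> unit_cube \<inter> U \<longrightarrow>
      \<phi> x + ereal ((- (1 / \<mu>) *\<^sub>R ?G) \<bullet> (y - x) - e * norm (y - x)) \<le> \<phi> y" if "e > 0" for e
  proof -
    have "\<mu> * e > 0" using \<open>\<mu> > 0\<close> that by simp
    from has_gradient_upper_bound[OF grad this] le show ?thesis
    proof eventually_elim
      case (elim y)
      show ?case
      proof
        assume "y \<in> unit_cube \<inter> U"
        with elim(2) have le_y: "objective f \<phi> \<mu> x \<le> objective f \<phi> \<mu> y" by simp
        show "\<phi> x + ereal ((- (1 / \<mu>) *\<^sub>R ?G) \<bullet> (y - x) - e * norm (y - x)) \<le> \<phi> y"
        proof (cases "\<phi> y")
          case (real s)
          have "a + \<mu> * r \<le> a + (?G \<bullet> (y - x) + \<mu> * e * norm (y - x)) + \<mu> * s"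
            using elim(1) le_y real r a by (cases "f y") (auto simp: objective_def)
          then have "\<mu> * (r - e * norm (y - x)) - ?G \<bullet> (y - x) \<le> \<mu> * s"
            by (simp add: algebra_simps)
          then have "r + (- (1 / \<mu>) * (?G \<bullet> (y - x)) - e * norm (y - x)) \<le> s"
            using \<open>\<mu> > 0\<close> by (simp add: field_simps)
          then show ?thesis by (simp add: r real)
        qed (use assms(1) in auto)
      qed
    qed
  qed
  have "\<forall>\<^sub>F z in nhds x. z \<in> U"
    using U by (intro eventually_nhds_in_open)
  then have near: "\<forall>\<^sub>F z in nhds x. z \<in> unit_cube \<longrightarrow> (\<forall>s. \<phi> z = ereal s \<longrightarrow>
      - (0 * (norm (z - x))\<^sup>2) \<le> ?G \<bullet> (z - x) + \<mu> * (s - r))"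
  proof (eventually_elim, intro impI allI)
    fix z s assume z: "z \<in> U" "z \<in> unit_cube" and s: "\<phi> z = ereal s"
    have "r + (- (1 / \<mu>) *\<^sub>R ?G) \<bullet> (z - x) \<le> s"
      by (rule convex_first_order_bound[OF conv' _ _ r s bound]) (use x z U in auto)
    then show "- (0 * (norm (z - x))\<^sup>2) \<le> ?G \<bullet> (z - x) + \<mu> * (s - r)"
      using \<open>\<mu> > 0\<close> by (simp add: field_simps)
  qed
  show ?thesis
    by (rule P_stationary_if_local_bound[where \<phi> = \<phi>, OF assms(1,2) _ x r near]) (rule assms(3))
qed

text \<open>Strong smoothness at the base point \<open>x\<close> replaces \<open>f z - f x\<close> by the linear model plus
  \<open>L / 2 * (norm (z - x))\<^sup>2\<close>, so local minimality is the local bound with constant \<open>L / 2\<close>.\<close>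

lemma P_stationary_if_local_minimizer_smooth:
  fixes x :: "real^'n"
  assumes "\<And>z. \<phi> z \<noteq> -\<infinity>" "\<mu> > 0" "\<And>z. z \<in> unit_cube \<Longrightarrow> 0 \<le> \<phi> z"
    and fin: "\<bar>f x\<bar> \<noteq> \<infinity>"
    and min: "local_minimizer_on unit_cube (objective f \<phi> \<mu>) x"
    and smooth: "strongly_smooth_on unit_cube L f"
  shows "P_stationary f \<phi> \<mu> x"
proof -
  obtain a where a: "f x = ereal a" using fin by auto
  obtain r where x: "x \<in> unit_cube" and r: "\<phi> x = ereal r"
    and le: "\<forall>\<^sub>F z in nhds x. z \<in> unit_cube \<longrightarrow> objective f \<phi> \<mu> x \<le> objective f \<phi> \<mu> z"
    using local_minimizer_onE[OF min assms(1,2) fin] by metis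
  from le have near: "\<forall>\<^sub>F z in nhds x. z \<in> unit_cube \<longrightarrow> (\<forall>s. \<phi> z = ereal s \<longrightarrow>
      - (L / 2 * (norm (z - x))\<^sup>2) \<le> gradient f x \<bullet> (z - x) + \<mu> * (s - r))"
  proof (eventually_elim, intro impI allI)
    fix z s
    assume "z \<in> unit_cube \<longrightarrow> objective f \<phi> \<mu> x \<le> objective f \<phi> \<mu> z"
      and z: "z \<in> unit_cube" and s: "\<phi> z = ereal s"
    then have "objective f \<phi> \<mu> x \<le> objective f \<phi> \<mu> z" by simp
    moreover have "f z \<le> f x + ereal (gradient f x \<bullet> (z - x)) + ereal (L / 2 * (norm (z - x))\<^sup>2)"
      using smooth x z unfolding strongly_smooth_on_def by blast
    ultimately show "- (L / 2 * (norm (z - x))\<^sup>2) \<le> gradient f x \<bullet> (z - x) + \<mu> * (s - r)"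
      by (cases "f z") (auto simp: objective_def a r s algebra_simps)
  qed
  show ?thesis
    by (rule P_stationary_if_local_bound[where \<phi> = \<phi>, OF assms(1,2) _ x r near]) (rule assms(3))
qed

text \<open>The quadratic gain from strong convexity pays for the quadratic loss in the variational
  inequality exactly when \<open>l / 2 \<ge> 1 / (2 * \<tau>)\<close>.\<close>

lemma global_minimizer_if_P_stationary:
  fixes x :: "real^'n"
  assumes "\<And>z. \<phi> z \<noteq> -\<infinity>" "\<mu> > 0" and fin: "\<And>z. z \<in> unit_cube \<Longrightarrow> \<bar>f z\<bar> \<noteq> \<infinity>"
    and P: "P_stationary_with f \<phi> \<mu> \<tau> x"
    and "l > 0" and conv: "strongly_convex_on unit_cube l f" and "\<tau> \<ge> 1 / l"
  shows "x \<in> argmin_on unit_cube (objective f \<phi> \<mu>)"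
proof -
  have "\<tau> > 0" and x: "x \<in> unit_cube" and "\<phi> x < \<infinity>"
    and ineq: "\<And>z r s. z \<in> unit_cube \<Longrightarrow> \<phi> x = ereal r \<Longrightarrow> \<phi> z = ereal s \<Longrightarrow>
        - ((norm (z - x))\<^sup>2 / (2 * \<tau>)) \<le> gradient f x \<bullet> (z - x) + \<mu> * (s - r)"
    using P by (auto simp: P_stationary_with_iff[OF assms(1,2)])
  obtain r where r: "\<phi> x = ereal r"
    using assms(1)[of x] \<open>\<phi> x < \<infinity>\<close> by (cases "\<phi> x") auto
  obtain a where a: "f x = ereal a"
    using fin[OF x] by auto
  have "objective f \<phi> \<mu> x \<le> objective f \<phi> \<mu> z" if z: "z \<in> unit_cube" for z
  proof -
    obtain b where b: "f z = ereal b" using fin[OF z] by auto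
    show ?thesis
    proof (cases "\<phi> z")
      case (real s)
      have "1 / \<tau> \<le> l"
        using \<open>\<tau> \<ge> 1 / l\<close> \<open>l > 0\<close> \<open>\<tau> > 0\<close> by (simp add: field_simps)
      then have "1 / \<tau> * ((norm (z - x))\<^sup>2 / 2) \<le> l * ((norm (z - x))\<^sup>2 / 2)"
        by (rule mult_right_mono) simp
      then have "(norm (z - x))\<^sup>2 / (2 * \<tau>) \<le> l / 2 * (norm (z - x))\<^sup>2"
        by (simp add: mult.commute)
      moreover have "a + gradient f x \<bullet> (z - x) + l / 2 * (norm (z - x))\<^sup>2 \<le> b"
        using conv x z a b unfolding strongly_convex_on_def by fastforce
      ultimately have "a + \<mu> * r \<le> b + \<mu> * s"
        using ineq[OF z r real] by (simp add: algebra_simps)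
      then show ?thesis by (simp add: objective_def a b r real)
    qed (use assms(1,2) b in \<open>auto simp: objective_def\<close>)
  qed
  moreover have "objective f \<phi> \<mu> x < \<infinity>"
    by (simp add: objective_def a r)
  ultimately show ?thesis
    using x unfolding argmin_on_def by blast
qed

section \<open>The relationships between the solution concepts\<close>

theorem theorem3p3:
  fixes f :: "real^'n \<Rightarrow> ereal" and g :: "real \<Rightarrow> ereal" and \<phi> :: "real^'n \<Rightarrow> ereal"
    and c \<mu> :: real
  assumes "\<And>x. f x \<noteq> -\<infinity>"
    and "continuously_differentiable_around unit_cube f"
    and "sharp_peak g c"
    and "\<phi> = separable_sum g"
    and "\<mu> > mu_bar f c"
  shows "(\<forall>x. P_stationary f \<phi> \<mu> x \<longrightarrow> KKT_point f \<phi> \<mu> x) \<and>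
         (\<forall>x. KKT_point f \<phi> \<mu> x \<and> locally_convex_at \<phi> x \<longrightarrow> P_stationary f \<phi> \<mu> x) \<and>
         (\<forall>x. local_minimizer_on unit_cube (objective f \<phi> \<mu>) x \<and>
              ((locally_convex_at f x \<and> locally_convex_at \<phi> x) \<or>
               (\<exists>L>0. strongly_smooth_on unit_cube L f))
              \<longrightarrow> P_stationary f \<phi> \<mu> x) \<and>
         (\<forall>x \<tau> l. P_stationary_with f \<phi> \<mu> \<tau> x \<and> l > 0 \<and> strongly_convex_on unit_cube l f \<and> \<tau> \<ge> 1 / l
              \<longrightarrow> x \<in> argmin_on unit_cube (objective f \<phi> \<mu>))"
proof -
  have sp: "\<And>t. g t \<noteq> -\<infinity>" "\<And>t. t \<in> {0..1} \<Longrightarrow> 0 \<le> g t" "c > 0"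
    using assms(3) by (auto simp: sharp_peak_def)
  have phi: "\<And>z. \<phi> z \<noteq> -\<infinity>"
    using separable_sum_not_MInf[OF sp(1)] by (simp add: assms(4))
  have nonneg: "0 \<le> \<phi> z" if "z \<in> unit_cube" for z
    unfolding assms(4) separable_sum_def
    by (intro sum_nonneg sp(2)) (use that in \<open>auto simp: mem_box_cart\<close>)
  have "mu_bar f c \<ge> 0"
    using mu_bar_attained[OF assms(2), of c] \<open>c > 0\<close> by (auto simp: infnorm_pos_le)
  with assms(5) have "\<mu> > 0" by simp
  have grad: "has_gradient f (gradient f x) x" if "x \<in> unit_cube" for x
    using assms(2) that gradient_eq unfolding continuously_differentiable_around_def
    by (metis subsetD)
  have fin: "\<bar>f x\<bar> \<noteq> \<infinity>" if "x \<in> unit_cube" for x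
    using grad[OF that] by (rule has_gradient_finite)
  have cube: "x \<in> unit_cube" if "local_minimizer_on unit_cube (objective f \<phi> \<mu>) x" for x
    using that unfolding local_minimizer_on_def argmin_on_def by blast
  show ?thesis
  proof (intro conjI allI impI)
    fix x assume "P_stationary f \<phi> \<mu> x"
    then show "KKT_point f \<phi> \<mu> x"
      unfolding assms(4) by (rule KKT_point_if_P_stationary[OF assms(3) \<open>\<mu> > 0\<close>])
  next
    fix x assume "KKT_point f \<phi> \<mu> x \<and> locally_convex_at \<phi> x"
    then show "P_stationary f \<phi> \<mu> x"
      by (intro P_stationary_if_KKT_point[where \<phi> = \<phi>, OF phi \<open>\<mu> > 0\<close>] nonneg) auto
  next
    fix x
    assume "local_minimizer_on unit_cube (objective f \<phi> \<mu>) x \<and>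
      ((locally_convex_at f x \<and> locally_convex_at \<phi> x) \<or>
       (\<exists>L>0. strongly_smooth_on unit_cube L f))"
    then have min: "local_minimizer_on unit_cube (objective f \<phi> \<mu>) x"
      and "locally_convex_at \<phi> x \<or> (\<exists>L. strongly_smooth_on unit_cube L f)"
      by auto
    then show "P_stationary f \<phi> \<mu> x"
    proof (elim disjE exE)
      assume "locally_convex_at \<phi> x"
      then show ?thesis
        by (intro P_stationary_if_local_minimizer_convex[where \<phi> = \<phi>, OF phi \<open>\<mu> > 0\<close>]
              nonneg grad[OF cube[OF min]] min)
    next
      fix L assume "strongly_smooth_on unit_cube L f"
      then show ?thesis
        by (intro P_stationary_if_local_minimizer_smooth[where \<phi> = \<phi>, OF phi \<open>\<mu> > 0\<close>]
              nonneg fin[OF cube[OF min]] min)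
    qed
  next
    fix x \<tau> l
    assume "P_stationary_with f \<phi> \<mu> \<tau> x \<and> l > 0 \<and> strongly_convex_on unit_cube l f \<and> \<tau> \<ge> 1 / l"
    then show "x \<in> argmin_on unit_cube (objective f \<phi> \<mu>)"
      by (intro global_minimizer_if_P_stationary[where \<phi> = \<phi>, OF phi \<open>\<mu> > 0\<close>] fin) auto
  qed
qed

end
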